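(* Let $p\ge 3$ and let $q$ be an integer with $p>q>0$ and $\gcd(p,q)=1$. Let $\Delta_1$ and $\Delta_2$ be two triangulations of a regular $p$-gon such that $\Delta_2$ is $\Delta_1$ rotated by the angle $2\pi q/p$. Then $$d(\Delta_1,\Delta_2)\ge E(p,q)-3 .$$
   Context: A triangulation of a regular $p$-gon is a triangulation by pairwise non-crossing diagonals, i.e. one whose vertices are exactly the vertices of the polygon. A flip of a triangulation replaces two triangles $ABC$ and $ACD$ having the common side $AC$ by the two triangles $BCD$ and $ABD$ with the common side $BD$ (it switches the diagonal in a triangulated quadrilateral). The rotation distance $d(\Delta_1,\Delta_2)$ is the minimal number of flips required to convert $\Delta_1$ into $\Delta_2$. For nonnegative integers $p,q$, not both zero, $E(p,q)$ is the number of subtractions (smaller number from larger) that the subtractive Euclid algorithm needs to convert the unordered pair $(p,q)$ into $(d,0)$, $d=\gcd(p,q)$. Equivalently, for $p,q>0$ it is the sum of the elements (partial quotients) of the continued fraction of $p/q$. *)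

theory Defs
  imports "HOL-Analysis.Analysis" "HOL-Library.Extended_Nat"
begin

(* The plane is the complex plane.  Every regular p-gon has this form: c is its
   centre and a, which should be nonzero, is the vector from c to one vertex. *)
definition regular_polygon_vertices :: "complex \<Rightarrow> complex \<Rightarrow> nat \<Rightarrow> complex set" where
  "regular_polygon_vertices c a p = (\<lambda>k. c + a * cis (2 * pi * real k / real p)) ` {..<p}"

(* A triangulation is the set of its closed triangles.  The library notion
   triangulation demands that any two members meet in a common face; since all
   corners are vertices of the polygon, every side of a triangle is a side or a
   diagonal of the polygon, and this says that the diagonals do not cross. *)
definition polygon_triangulation ::
    "complex \<Rightarrow> complex \<Rightarrow> nat \<Rightarrow> complex set set \<Rightarrow> bool" where
  "polygon_triangulation c a p T \<longleftrightarrow>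
     triangulation T \<and>
     (\<forall>t\<in>T. 2 simplex t) \<and>
     \<Union>T = convex hull (regular_polygon_vertices c a p) \<and>
     {v. \<exists>t\<in>T. v extreme_point_of t} = regular_polygon_vertices c a p"

(* As the members of T are nondegenerate triangles, A, B, C, D are automatically
   pairwise distinct once B and D are. *)
definition flip ::
    "complex \<Rightarrow> complex \<Rightarrow> nat \<Rightarrow> complex set set \<Rightarrow> complex set set \<Rightarrow> bool" where
  "flip c a p T T' \<longleftrightarrow>
     polygon_triangulation c a p T \<and> polygon_triangulation c a p T' \<and>
     (\<exists>A B C D. B \<noteq> D \<and>
        convex hull {A, B, C} \<in> T \<and> convex hull {A, C, D} \<in> T \<and>
        T' = (T - {convex hull {A, B, C}, convex hull {A, C, D}})
               \<union> {convex hull {B, C, D}, convex hull {A, B, D}})"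

(* The infimum of a nonempty set of extended naturals is attained; the value
   infinity would mean that no sequence of flips leads from T to T'. *)
definition rotation_distance ::
    "complex \<Rightarrow> complex \<Rightarrow> nat \<Rightarrow> complex set set \<Rightarrow> complex set set \<Rightarrow> enat" where
  "rotation_distance c a p T T' = (INF n\<in>{n. (flip c a p ^^ n) T T'}. enat n)"

definition rotate_about :: "complex \<Rightarrow> real \<Rightarrow> complex \<Rightarrow> complex" where
  "rotate_about c \<theta> z = c + cis \<theta> * (z - c)"

(* The value at (0, 0) is a junk value. *)
fun euclid_subtractions :: "nat \<Rightarrow> nat \<Rightarrow> nat" where
  "euclid_subtractions 0 q = 0"
| "euclid_subtractions (Suc p) 0 = 0"
| "euclid_subtractions (Suc p) (Suc q) =
     Suc (if p < q then euclid_subtractions (Suc p) (Suc q - Suc p)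
          else euclid_subtractions (Suc p - Suc q) (Suc q))"

end

theory Submission
  imports Defs
begin

text \<open>
  Consider the sides and diagonals occurring in a triangulation \<open>\<Delta>\<close> of the \<open>p\<close>-gon. There are
  at least \<open>2p - 3\<close> of them, and a flip destroys only one. So it is enough that
  \<open>\<Delta>\<close> and its rotation by \<open>q\<close> vertices share at most \<open>2p - E(p,q)\<close> chords. More generally, in
  every noncrossing set \<open>S\<close> of chords at most \<open>2p - E(p,q)\<close> chords \<open>e\<close> are paired, that is,
  have \<open>e + q\<close> in \<open>S\<close> too. We may assume \<open>2q < p\<close>; then paired chords span at most \<open>q\<close> sides. A chord
  \<open>I\<close> spanning exactly \<open>q\<close> sides from the start of a longest paired chord can be added to \<open>S\<close> once the
  unpaired chords are dropped. Collapsing \<open>I\<close> to a point gives a noncrossing set on \<open>p - q\<close>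
  points, in which rotation by \<open>q\<close> skips over the collapsed arc. At most as many pairs are lost as
  there are chords on the \<open>q + 1\<close> vertices of \<open>I\<close>, that is \<open>2q - 1\<close>; this matches one
  subtraction \<open>(p,q) \<mapsto> (p-q,q)\<close>.
\<close>

subsection \<open>Periodic noncrossing arcs\<close>

text \<open>Chords of a \<open>p\<close>-gon are lifted to pairs of integers, modulo the diagonal translation by \<open>p\<close>.\<close>

definition arc_system :: "int \<Rightarrow> (int \<times> int) set \<Rightarrow> bool" where
  "arc_system p S \<longleftrightarrow>
     (\<forall>x y. (x, y) \<in> S \<longrightarrow> x < y) \<and>
     (\<forall>x y. (x + p, y + p) \<in> S \<longleftrightarrow> (x, y) \<in> S) \<and>
     (\<forall>x y x' y'. (x, y) \<in> S \<longrightarrow> (x', y') \<in> S \<longrightarrow> \<not> (x < x' \<and> x' < y \<and> y < y'))"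

definition paired :: "int \<Rightarrow> (int \<times> int) set \<Rightarrow> (int \<times> int) set" where
  "paired q S = {(x, y). (x, y) \<in> S \<and> (x + q, y + q) \<in> S}"

text \<open>For a set invariant under translation by \<open>p\<close> this picks one representative
  of each translation class, so that the infinite lift can be counted.\<close>

definition window :: "int \<Rightarrow> int \<Rightarrow> (int \<times> int) set \<Rightarrow> (int \<times> int) set" where
  "window v p P = {(x, y). (x, y) \<in> P \<and> v \<le> x \<and> x < v + p}"

lemma arc_systemD:
  assumes "arc_system p S"
  shows "(x, y) \<in> S \<Longrightarrow> x < y"
    and "(x + p, y + p) \<in> S \<longleftrightarrow> (x, y) \<in> S"
    and "(x, y) \<in> S \<Longrightarrow> (x', y') \<in> S \<Longrightarrow> x < x' \<Longrightarrow> x' < y \<Longrightarrow> y' \<le> y"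
  using assms unfolding arc_system_def by (blast, blast, meson not_le)

lemma periodic_mult:
  fixes p k :: int
  assumes "\<And>x y. (x + p, y + p) \<in> P \<longleftrightarrow> (x, y) \<in> P"
  shows "(x + k * p, y + k * p) \<in> P \<longleftrightarrow> (x, y) \<in> P"
proof (induction k rule: int_induct[where k = 0])
  case (step1 i)
  then show ?case using assms[of "x + i * p" "y + i * p"] by (simp add: algebra_simps)
next
  case (step2 i)
  then show ?case using assms[of "x + (i - 1) * p" "y + (i - 1) * p"] by (simp add: algebra_simps)
qed simp

text \<open>Translating each arc by the multiple of \<open>p\<close> that brings its left end into
  \<open>[w, w + p)\<close> is injective on a window. Used in both directions, this makes the count
  independent of where the window starts.\<close>

lemma card_window_le:
  fixes p v w :: int
  assumes per: "\<And>x y. (x + p, y + p) \<in> P \<longleftrightarrow> (x, y) \<in> P"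
    and "0 < p" and fin: "finite (window w p P)"
  shows "card (window v p P) \<le> card (window w p P)"
proof -
  define k where "k x = - ((x - w) div p)" for x
  have k: "x + k x * p = w + (x - w) mod p" for x
    using div_mult_mod_eq[of "x - w" p] by (simp add: k_def algebra_simps)
  define f where "f = (\<lambda>(x, y). (x + k x * p, y + k x * p))"
  have "f ` window v p P \<subseteq> window w p P"
  proof
    fix e assume "e \<in> f ` window v p P"
    then obtain x y where e: "e = (x + k x * p, y + k x * p)" and xy: "(x, y) \<in> P"
      by (auto simp: f_def window_def)
    have "e \<in> P" using e xy periodic_mult[OF per] by simp
    moreover have "w \<le> x + k x * p" "x + k x * p < w + p"
      unfolding k using \<open>0 < p\<close> by auto
    ultimately show "e \<in> window w p P" using e by (simp add: window_def)
  qed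
  moreover have "inj_on f (window v p P)"
  proof (rule inj_onI)
    fix d e assume d: "d \<in> window v p P" and e: "e \<in> window v p P" and eq: "f d = f e"
    obtain x y where xy: "d = (x, y)" by force
    obtain x' y' where xy': "e = (x', y')" by force
    have r: "v \<le> x" "x < v + p" "v \<le> x'" "x' < v + p"
      using d e xy xy' by (auto simp: window_def)
    have 1: "x + k x * p = x' + k x' * p" and 2: "y + k x * p = y' + k x' * p"
      using eq xy xy' by (auto simp: f_def)
    have "x mod p = x' mod p"
      by (metis 1 mod_mult_self1)
    then have "(x - v) mod p = (x' - v) mod p" by (metis mod_diff_left_eq)
    then have "x = x'" using r by (simp add: mod_pos_pos_trivial)
    then show "d = e" using 2 xy xy' by simp
  qed
  ultimately show ?thesis using card_inj_on_le fin by blast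
qed

lemma paired_periodic:
  assumes "arc_system p S"
  shows "(x + p, y + p) \<in> paired q S \<longleftrightarrow> (x, y) \<in> paired q S"
  using arc_systemD(2)[OF assms, of x y] arc_systemD(2)[OF assms, of "x + q" "y + q"]
  by (simp add: paired_def algebra_simps)

text \<open>An arc longer than \<open>q\<close> would cross its own shift by \<open>q\<close>. If it
  were longer than \<open>p - q\<close>, its shift by \<open>q\<close> would cross its translate by
  \<open>p\<close>.\<close>

lemma paired_length:
  assumes S: "arc_system p S" and q: "0 < q" "q < p" and e: "(x, y) \<in> paired q S"
  shows "x < y" "y - x \<le> q" "y - x \<le> p - q"
proof -
  have e1: "(x, y) \<in> S" and e2: "(x + q, y + q) \<in> S" using e by (auto simp: paired_def)
  have e3: "(x + p, y + p) \<in> S" using arc_systemD(2)[OF S] e1 by simp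
  show "x < y" using arc_systemD(1)[OF S e1] .
  show "y - x \<le> q" using arc_systemD(3)[OF S e1 e2] q by linarith
  show "y - x \<le> p - q" using arc_systemD(3)[OF S e2 e3] q by linarith
qed

lemma finite_window_paired:
  assumes "arc_system p S" and "0 < q" "q < p"
  shows "finite (window v p (paired q S))"
proof (rule finite_subset)
  show "window v p (paired q S) \<subseteq> {v..<v + p} \<times> {v..<v + p + q + 1}"
    using paired_length[OF assms] by (fastforce simp: window_def)
qed simp

lemma card_window_paired:
  assumes "arc_system p S" and "0 < q" "q < p"
  shows "card (window v p (paired q S)) = card (window w p (paired q S))"
  using assms
  by (intro antisym card_window_le paired_periodic finite_window_paired) auto

text \<open>If an arc is paired by \<open>q\<close>, its shift by \<open>q\<close> is paired by
  \<open>p - q\<close>, because the two shifts compose to the period \<open>p\<close>. This allows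
  the reduction to \<open>2 * q \<le> p\<close>.\<close>

lemma card_paired_complement:
  assumes S: "arc_system p S" and q: "0 < q" "q < p"
  shows "card (window 0 p (paired q S)) \<le> card (window 0 p (paired (p - q) S))"
proof -
  have "(\<lambda>(x, y). (x + q, y + q)) ` window 0 p (paired q S) \<subseteq> window q p (paired (p - q) S)"
    using arc_systemD(2)[OF S] by (auto simp: window_def paired_def)
  moreover have "inj_on (\<lambda>(x, y). (x + q, y + q)) (window 0 p (paired q S))"
    by (auto simp: inj_on_def)
  ultimately have "card (window 0 p (paired q S)) \<le> card (window q p (paired (p - q) S))"
    using card_inj_on_le finite_window_paired[OF S, of "p - q" q] q by auto
  also have "\<dots> = card (window 0 p (paired (p - q) S))"
    using card_window_paired[OF S, of "p - q"] q by simp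
  finally show ?thesis .
qed

text \<open>The bound is the number of sides and diagonals in a triangulated polygon with
  \<open>b - a + 1\<close> vertices. The induction splits at a point \<open>c\<close> over which no
  arc except \<open>(a, b)\<close> passes, and
  \<open>(2 * (c - a) - 1) + (2 * (b - c) - 1) + 1\<close> is the claimed bound.\<close>

lemma card_noncrossing_arcs:
  fixes a b :: int
  assumes "a < b"
    and "F \<subseteq> {(x, y). a \<le> x \<and> x < y \<and> y \<le> b}"
    and "\<And>x y x' y'. (x, y) \<in> F \<Longrightarrow> (x', y') \<in> F \<Longrightarrow> x < x' \<Longrightarrow> x' < y \<Longrightarrow> y' \<le> y"
  shows "int (card F) \<le> 2 * (b - a) - 1"
  using assms
proof (induction "nat (b - a)" arbitrary: a b F rule: less_induct)
  case less
  have fin: "finite F"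
    by (rule finite_subset[OF less.prems(2)], rule finite_subset[of _ "{a..b} \<times> {a..b}"]) auto
  show ?case
  proof (cases "b = a + 1")
    case True
    then have "F \<subseteq> {(a, b)}" using less.prems(2) by auto
    then have "card F \<le> 1" using card_mono[of "{(a, b)}" F] by simp
    then show ?thesis using True by simp
  next
    case False
    \<comment> \<open>The split point is the farthest neighbour of \<open>a\<close> other than
      \<open>b\<close>, or \<open>a + 1\<close> if there is none. An arc over it starting at
      \<open>a\<close> contradicts maximality, and one starting later crosses
      \<open>(a, c)\<close>.\<close>
    define Y where "Y = insert (a + 1) {y. (a, y) \<in> F \<and> y \<noteq> b}"
    have "Y \<subseteq> {a<..<b}" using False less.prems(1,2) by (auto simp: Y_def)
    then have finY: "finite Y" using finite_subset by blast
    define c where "c = Max Y"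
    have cY: "c \<in> Y" unfolding c_def using finY by (rule Max_in) (simp add: Y_def)
    then have c: "a < c" "c < b" using \<open>Y \<subseteq> {a<..<b}\<close> by auto
    define L where "L = {(x, y). (x, y) \<in> F \<and> y \<le> c}"
    define R where "R = {(x, y). (x, y) \<in> F \<and> c \<le> x}"
    have "F \<subseteq> insert (a, b) (L \<union> R)"
    proof (rule ccontr)
      assume "\<not> F \<subseteq> insert (a, b) (L \<union> R)"
      then obtain x y where xy: "(x, y) \<in> F" and ne: "(x, y) \<notin> L \<union> R" "(x, y) \<noteq> (a, b)" by force
      then have xcy: "x < c" "c < y" by (auto simp: L_def R_def)
      have ax: "a \<le> x" using xy less.prems(2) by auto
      show False
      proof (cases "x = a")
        case True
        then have "y \<in> Y" using xy ne by (auto simp: Y_def)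
        then have "y \<le> c" unfolding c_def by (rule Max_ge[OF finY])
        then show False using xcy by simp
      next
        case False
        then have "c \<noteq> a + 1" using xcy ax by linarith
        then have "(a, c) \<in> F" using cY by (auto simp: Y_def)
        then show False using less.prems(3)[of a c x y] xy xcy ax False by force
      qed
    qed
    moreover have "finite L" "finite R"
      by (rule finite_subset[OF _ fin], force simp: L_def R_def)+
    ultimately have "card F \<le> card (insert (a, b) (L \<union> R))" by (intro card_mono) auto
    also have "\<dots> \<le> Suc (card L + card R)"
      using card_Un_le[of L R] \<open>finite L\<close> \<open>finite R\<close> by (simp add: card_insert_if)
    finally have "int (card F) \<le> 1 + int (card L) + int (card R)" by linarith
    moreover have "int (card L) \<le> 2 * (c - a) - 1"
    proof (rule less.hyps)
      show "nat (c - a) < nat (b - a)" using c by simp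
      show "L \<subseteq> {(x, y). a \<le> x \<and> x < y \<and> y \<le> c}" using less.prems(2) by (auto simp: L_def)
      show "\<And>x y x' y'. (x, y) \<in> L \<Longrightarrow> (x', y') \<in> L \<Longrightarrow> x < x' \<Longrightarrow> x' < y \<Longrightarrow> y' \<le> y"
        using less.prems(3) unfolding L_def by blast
    qed (use c in simp)
    moreover have "int (card R) \<le> 2 * (b - c) - 1"
    proof (rule less.hyps)
      show "nat (b - c) < nat (b - a)" using c by simp
      show "R \<subseteq> {(x, y). c \<le> x \<and> x < y \<and> y \<le> b}" using less.prems(2) by (auto simp: R_def)
      show "\<And>x y x' y'. (x, y) \<in> R \<Longrightarrow> (x', y') \<in> R \<Longrightarrow> x < x' \<Longrightarrow> x' < y \<Longrightarrow> y' \<le> y"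
        using less.prems(3) unfolding R_def by blast
    qed (use c in simp)
    ultimately show ?thesis by (simp add: algebra_simps)
  qed
qed

subsection \<open>Collapsing an arc\<close>

text \<open>Contracts each of the intervals \<open>[k p, k p + q]\<close> to the point \<open>k (p - q)\<close>.\<close>
definition collapse :: "int \<Rightarrow> int \<Rightarrow> int \<Rightarrow> int" where
  "collapse p q x = (x div p) * (p - q) + max 0 (x mod p - q)"

lemma collapse_add:
  assumes "0 < p"
  shows "collapse p q (x + p) = collapse p q x + (p - q)"
  using assms by (simp add: collapse_def algebra_simps)

lemma collapse_mono:
  assumes q: "0 < q" "q < p" and "x \<le> y"
  shows "collapse p q x \<le> collapse p q y"
proof (cases "x div p = y div p")
  case True
  then have "x div p * p = y div p * p" by simp
  then have "x mod p \<le> y mod p"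
    using \<open>x \<le> y\<close> div_mult_mod_eq[of x p] div_mult_mod_eq[of y p] by linarith
  then show ?thesis using True by (simp add: collapse_def)
next
  case False
  then have "x div p + 1 \<le> y div p" using zdiv_mono1[OF \<open>x \<le> y\<close>, of p] q by linarith
  then have "(x div p + 1) * (p - q) \<le> (y div p) * (p - q)" using q by (intro mult_right_mono) auto
  moreover have "max 0 (x mod p - q) \<le> p - q" using pos_mod_bound[of p x] q by linarith
  ultimately show ?thesis by (simp add: collapse_def algebra_simps)
qed

lemma collapse_left:
  assumes q: "0 < q" "2 * q < p" and x: "- q \<le> x" "x \<le> 0"
  shows "collapse p q x = x"
proof (cases "x = 0")
  case False
  have "x div p = -1" by (rule int_div_pos_eq[of _ _ _ "x + p"]) (use q x False in auto)
  moreover have "x mod p = x + p" by (rule int_mod_pos_eq[of _ _ "-1"]) (use q x False in auto)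
  ultimately show ?thesis using q x by (simp add: collapse_def)
qed (use q in \<open>simp add: collapse_def\<close>)

lemma collapse_right:
  assumes q: "0 < q" "2 * q < p" and x: "q \<le> x" "x \<le> p"
  shows "collapse p q x = x - q"
proof (cases "x = p")
  case False
  then show ?thesis using q x by (simp add: collapse_def)
qed (use q in \<open>simp add: collapse_def\<close>)

text \<open>Since \<open>collapse\<close> is weakly monotone, strict inequalities between images
  lift to the original points, so a crossing after the collapse comes from a crossing before it.
  Arcs shrunk to a point are dropped.\<close>

lemma arc_system_collapse:
  assumes S: "arc_system p S" and q: "0 < q" "2 * q < p"
  defines "S' \<equiv> {(collapse p q x, collapse p q y) | x y. (x, y) \<in> S \<and> collapse p q x < collapse p q y}"
  shows "arc_system (p - q) S'"
proof -
  have less: "x < y" if "collapse p q x < collapse p q y" for x y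
    using collapse_mono[of q p y x] q that by linarith
  have per1: "(X + (p - q), Y + (p - q)) \<in> S'" if XY: "(X, Y) \<in> S'" for X Y
  proof -
    obtain x y where *: "X = collapse p q x" "Y = collapse p q y" "(x, y) \<in> S" "X < Y"
      using XY by (auto simp: S'_def)
    then have "X + (p - q) = collapse p q (x + p)" "Y + (p - q) = collapse p q (y + p)"
        "(x + p, y + p) \<in> S"
      using q arc_systemD(2)[OF S] by (auto simp: collapse_add)
    then show ?thesis unfolding S'_def using *(4)
      by (intro CollectI exI[of _ "x + p"] exI[of _ "y + p"]) auto
  qed
  have per2: "(X, Y) \<in> S'" if XY: "(X + (p - q), Y + (p - q)) \<in> S'" for X Y
  proof -
    obtain x y where *: "X + (p - q) = collapse p q x" "Y + (p - q) = collapse p q y" "(x, y) \<in> S" "X < Y"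
      using XY by (auto simp: S'_def)
    then have "X = collapse p q (x - p)" "Y = collapse p q (y - p)" "(x - p, y - p) \<in> S"
      using q arc_systemD(2)[OF S, of "x - p" "y - p"] collapse_add[of p q "x - p"] collapse_add[of p q "y - p"]
      by auto
    then show ?thesis unfolding S'_def using *(4)
      by (intro CollectI exI[of _ "x - p"] exI[of _ "y - p"]) auto
  qed
  have "\<not> (X < X' \<and> X' < Y \<and> Y < Y')" if m: "(X, Y) \<in> S'" "(X', Y') \<in> S'" for X Y X' Y'
  proof
    assume lt: "X < X' \<and> X' < Y \<and> Y < Y'"
    obtain x y where 1: "X = collapse p q x" "Y = collapse p q y" "(x, y) \<in> S"
      using m(1) unfolding S'_def by blast
    obtain x' y' where 2: "X' = collapse p q x'" "Y' = collapse p q y'" "(x', y') \<in> S"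
      using m(2) unfolding S'_def by blast
    have "x < x'" "x' < y" "y < y'" using less lt 1 2 by auto
    then show False using arc_systemD(3)[OF S 1(3) 2(3)] by simp
  qed
  moreover have "\<forall>x y. (x, y) \<in> S' \<longrightarrow> x < y" by (auto simp: S'_def)
  ultimately show ?thesis using per1 per2 unfolding arc_system_def by blast
qed

text \<open>With the window started at \<open>-q\<close>, the paired arcs split into those left of
  \<open>I\<close>, on \<open>I\<close> and right of it (\<open>A\<close>, \<open>B\<close>,
  \<open>C\<close>). Shifting \<open>A\<close> by \<open>q\<close> puts it on \<open>[0, q]\<close>
  as \<open>U\<close>, and
  \<open>card U + card B = card (U \<union> B) + card (U \<inter> B)\<close>. The union is
  noncrossing on \<open>q + 1\<close> points, which gives \<open>2 * q - 1\<close>; the arcs in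
  \<open>U \<inter> B\<close> and \<open>C\<close> yield distinct pairs of the collapsed
  system.\<close>

lemma paired_collapse_step:
  assumes S: "arc_system p S" and q: "0 < q" "2 * q < p" and I: "(0, q) \<in> S"
  shows "\<exists>S'. arc_system (p - q) S' \<and>
     int (card (window 0 p (paired q S))) \<le> 2 * q - 1 + int (card (window 0 (p - q) (paired q S')))"
proof -
  define S' where "S' = {(collapse p q x, collapse p q y) | x y. (x, y) \<in> S \<and> collapse p q x < collapse p q y}"
  have S': "arc_system (p - q) S'" unfolding S'_def by (rule arc_system_collapse[OF S q])
  have qp: "q < p" using q by simp
  note len = paired_length[OF S q(1) qp]
  have Ip: "(p, p + q) \<in> S" using arc_systemD(2)[OF S, of 0 q] I by (simp add: add.commute)
  define A where "A = {(x, y). (x, y) \<in> paired q S \<and> - q \<le> x \<and> y \<le> 0}"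
  define B where "B = {(x, y). (x, y) \<in> paired q S \<and> 0 \<le> x \<and> y \<le> q}"
  define C where "C = {(x, y). (x, y) \<in> paired q S \<and> q \<le> x \<and> y \<le> p - q}"
  define U where "U = (\<lambda>(x, y). (x + q, y + q)) ` A"
  txt \<open>An arc counted in both \<open>U\<close> and \<open>B\<close> sits in the middle of two consecutive pairs, which
    merge into one pair when it is collapsed; all other arcs on \<open>[0, q]\<close> cost at most one pair.\<close>
  have sub: "window (-q) p (paired q S) \<subseteq> A \<union> B \<union> C"
  proof
    fix e assume e: "e \<in> window (-q) p (paired q S)"
    obtain x y where xy: "e = (x, y)" by force
    have P: "(x, y) \<in> paired q S" and x: "- q \<le> x" "x < p - q"
      using e xy by (auto simp: window_def)
    have s: "(x, y) \<in> S" "(x + q, y + q) \<in> S" using P by (auto simp: paired_def)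
    \<comment> \<open>The arc \<open>(0, q)\<close> confines the shifts of the left arcs and the
      middle arcs themselves; its translate \<open>(p, p + q)\<close> confines the shifts of the
      right arcs.\<close>
    consider "x < 0" | "0 \<le> x" "x < q" | "q \<le> x" by linarith
    then show "e \<in> A \<union> B \<union> C"
    proof cases
      case 1
      have "y \<le> 0" using arc_systemD(3)[OF S I s(2)] len[OF P] x 1 by (cases "x = - q") auto
      then show ?thesis using xy P x by (simp add: A_def)
    next
      case 2
      have "y \<le> q" using arc_systemD(3)[OF S I s(1)] len[OF P] 2 by (cases "x = 0") auto
      then show ?thesis using xy P 2 by (simp add: B_def)
    next
      case 3
      have "y \<le> p - q" using arc_systemD(3)[OF S s(2) Ip] len[OF P] x by force
      then show ?thesis using xy P 3 by (simp add: C_def)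
    qed
  qed
  have bnd: "finite X" if "X \<subseteq> {(x, y). x < y \<and> l \<le> x \<and> y \<le> r}" for X :: "(int \<times> int) set" and l r
    by (rule finite_subset[OF that], rule finite_subset[of _ "{l..r} \<times> {l..r}"]) auto
  have finA: "finite A" by (rule bnd[of _ "-q" 0]) (use len in \<open>auto simp: A_def\<close>)
  have finB: "finite B" by (rule bnd[of _ 0 q]) (use len in \<open>auto simp: B_def\<close>)
  have finC: "finite C" by (rule bnd[of _ q "p - q"]) (use len in \<open>auto simp: C_def\<close>)
  have finU: "finite U" using finA by (simp add: U_def)
  have "card A = card U" unfolding U_def by (rule card_image[symmetric]) (auto simp: inj_on_def)
  moreover have "card (window (-q) p (paired q S)) \<le> card (A \<union> B \<union> C)"
    using sub finA finB finC by (intro card_mono) auto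
  moreover have "card (A \<union> B \<union> C) \<le> card A + card B + card C"
    using card_Un_le[of "A \<union> B" C] card_Un_le[of A B] by linarith
  moreover have "card U + card B = card (U \<union> B) + card (U \<inter> B)"
    by (rule card_Un_Int[OF finU finB])
  moreover have UB: "int (card (U \<union> B)) \<le> 2 * (q - 0) - 1"
  proof (rule card_noncrossing_arcs)
    have "U \<union> B \<subseteq> S" by (auto simp: U_def A_def B_def paired_def)
    then show "\<And>x y x' y'. (x, y) \<in> U \<union> B \<Longrightarrow> (x', y') \<in> U \<union> B \<Longrightarrow> x < x' \<Longrightarrow> x' < y \<Longrightarrow> y' \<le> y"
      using arc_systemD(3)[OF S] by blast
    show "U \<union> B \<subseteq> {(x, y). 0 \<le> x \<and> x < y \<and> y \<le> q}"
      using len by (auto simp: U_def A_def B_def)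
  qed (use q in simp)
  moreover have "card C + card (U \<inter> B) \<le> card (window (-q) (p - q) (paired q S'))"
  proof -
    \<comment> \<open>Beyond \<open>q\<close> the collapse subtracts \<open>q\<close>, so an arc of
      \<open>C\<close> and its partner both move by \<open>-q\<close>. For an arc of
      \<open>U \<inter> B\<close>, \<open>g\<close> returns its predecessor, whose partner after the
      collapse is the image of the arc \<open>2 * q\<close> further on.\<close>
    define g where "g = (\<lambda>(x, y). (x - q, y - q) :: int \<times> int)"
    have inj: "inj_on g X" for X by (auto simp: g_def inj_on_def)
    have mem: "(collapse p q x, collapse p q y) \<in> S'" if "(x, y) \<in> S" "collapse p q x < collapse p q y" for x y
      using that by (auto simp: S'_def)
    have gC: "g ` C \<subseteq> window (-q) (p - q) (paired q S')"
    proof (clarsimp simp: C_def g_def)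
      fix x y assume P: "(x, y) \<in> paired q S" and r: "q \<le> x" "y \<le> p - q"
      have s: "(x, y) \<in> S" "(x + q, y + q) \<in> S" using P by (auto simp: paired_def)
      have "collapse p q x = x - q" "collapse p q y = y - q"
        "collapse p q (x + q) = x" "collapse p q (y + q) = y"
        using collapse_right[OF q] r len[OF P] q by auto
      then have "(x - q, y - q) \<in> S'" "(x, y) \<in> S'"
        using mem[OF s(1)] mem[OF s(2)] len[OF P] by auto
      then show "(x - q, y - q) \<in> window (-q) (p - q) (paired q S')"
        using r len[OF P] q by (simp add: window_def paired_def)
    qed
    have gU: "g ` (U \<inter> B) \<subseteq> window (-q) (p - q) (paired q S')"
    proof (clarsimp simp: U_def A_def B_def g_def)
      fix x y assume P: "(x, y) \<in> paired q S" and P2: "(x + q, y + q) \<in> paired q S"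
        and r: "- q \<le> x" "y \<le> 0" 
      have s: "(x, y) \<in> S" "(x + q + q, y + q + q) \<in> S" using P P2 by (auto simp: paired_def)
      have "collapse p q x = x" "collapse p q y = y"
        using collapse_left[OF q] r len[OF P] q by auto
      moreover have "collapse p q (x + q + q) = x + q" "collapse p q (y + q + q) = y + q"
        using collapse_right[OF q, of "x + q + q"] collapse_right[OF q, of "y + q + q"] r len[OF P] q by auto
      ultimately have "(x, y) \<in> S'" "(x + q, y + q) \<in> S'"
        using mem[OF s(1)] mem[OF s(2)] len[OF P] by auto
      then show "(x, y) \<in> window (-q) (p - q) (paired q S')"
        using r len[OF P] q by (simp add: window_def paired_def)
    qed
    have "g ` C \<inter> g ` (U \<inter> B) = {}"
      using len q by (force simp: C_def B_def g_def)
    then have "card (g ` C \<union> g ` (U \<inter> B)) = card (g ` C) + card (g ` (U \<inter> B))"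
      using finC finB by (intro card_Un_disjoint) auto
    also have "\<dots> = card C + card (U \<inter> B)" using card_image[OF inj] by simp
    finally show ?thesis
      using card_mono[OF finite_window_paired[OF S', of q "-q"], of "g ` C \<union> g ` (U \<inter> B)"] gC gU q by simp
  qed
  moreover have "card (window (-q) p (paired q S)) = card (window 0 p (paired q S))"
    by (rule card_window_paired[OF S q(1) qp])
  moreover have "card (window (-q) (p - q) (paired q S')) = card (window 0 (p - q) (paired q S'))"
    by (rule card_window_paired[OF S']) (use q in auto)
  ultimately have "card (window 0 p (paired q S)) \<le> card (U \<union> B) + card (window 0 (p - q) (paired q S'))"
    by linarith
  then have "int (card (window 0 p (paired q S))) \<le> int (card (U \<union> B)) + int (card (window 0 (p - q) (paired q S')))"
    by (simp only: of_nat_add [symmetric] of_nat_le_iff)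
  then have "int (card (window 0 p (paired q S))) \<le> 2 * q - 1 + int (card (window 0 (p - q) (paired q S')))"
    using UB by simp
  then show ?thesis using S' by blast
qed

section \<open>Inserting an arc that spans \<open>q\<close> sides\<close>

lemma arc_system_translate:
  assumes "arc_system p S"
  shows "arc_system p {(x, y). (x + v, y + v) \<in> S}"
proof -
  have "(x + p + v, y + p + v) \<in> S \<longleftrightarrow> (x + v, y + v) \<in> S" for x y
    using arc_systemD(2)[OF assms, of "x + v" "y + v"] by (simp add: algebra_simps)
  then show ?thesis
    using arc_systemD(1)[OF assms] arc_systemD(3)[OF assms] unfolding arc_system_def
    by (fastforce simp: not_less)
qed

text \<open>Keeping just the paired arcs and their shifts by \<open>q\<close> loses no pair and
  bounds all remaining lengths by the maximal length \<open>m\<close> of a paired arc. This makes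
  room for an arc of span \<open>q\<close> starting where a longest paired arc starts; a translation
  then moves that start to \<open>0\<close>.\<close>

lemma arc_system_add_arc:
  assumes S: "arc_system p S" and q: "0 < q" "2 * q < p"
  shows "\<exists>S'. arc_system p S' \<and> (0, q) \<in> S' \<and>
     card (window 0 p (paired q S)) \<le> card (window 0 p (paired q S'))"
proof -
  define P where "P = paired q S"
  have qp: "q < p" using q by simp
  note len = paired_length[OF S q(1) qp, folded P_def]
  have perP: "(x + p, y + p) \<in> P \<longleftrightarrow> (x, y) \<in> P" for x y
    unfolding P_def by (rule paired_periodic[OF S])
  \<comment> \<open>If \<open>P\<close> is empty, \<open>v\<close> and \<open>m\<close> are
    arbitrary and the new arcs alone form the system.\<close>
  obtain v m where v: "P = {} \<or> (v, v + m) \<in> P" and max: "\<And>x y. (x, y) \<in> P \<Longrightarrow> y - x \<le> m"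
  proof (cases "P = {}")
    case False
    then obtain x0 y0 where xy0: "(x0, y0) \<in> P" by force
    define L where "L = (\<lambda>(x, y). y - x) ` P"
    have "L \<subseteq> {0..q}" using len by (force simp: L_def)
    then have finL: "finite L" using finite_subset by blast
    have "L \<noteq> {}" using False by (simp add: L_def)
    then have "Max L \<in> L" using finL by simp
    then obtain v y where vy: "(v, y) \<in> P" "y - v = Max L" by (auto simp: L_def)
    have "y' - x' \<le> Max L" if "(x', y') \<in> P" for x' y'
      by (rule Max_ge[OF finL]) (use that in \<open>force simp: L_def\<close>)
    then show ?thesis using that[of v "Max L"] vy by (metis add.commute diff_add_cancel)
  qed auto
  define S0 where "S0 = P \<union> {(x, y). (x - q, y - q) \<in> P}"
  have S0S: "S0 \<subseteq> S" by (auto simp: S0_def P_def paired_def)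
  have len0: "x < y \<and> y - x \<le> q \<and> y - x \<le> m" if "(x, y) \<in> S0" for x y
    using that len[of x y] max[of x y] len[of "x - q" "y - q"] max[of "x - q" "y - q"]
    by (auto simp: S0_def)
  define J where "J = {(v + k * p, v + k * p + q) | k. True}"
  define S1 where "S1 = S0 \<union> J"
  have per0: "(x + p, y + p) \<in> S0 \<longleftrightarrow> (x, y) \<in> S0" for x y
    using perP[of x y] perP[of "x - q" "y - q"] by (simp add: S0_def algebra_simps)
  have perJ: "(x + p, y + p) \<in> J \<longleftrightarrow> (x, y) \<in> J" for x y
  proof
    assume "(x + p, y + p) \<in> J"
    then obtain k where "x + p = v + k * p" "y + p = v + k * p + q" by (auto simp: J_def)
    then have "x = v + (k - 1) * p" "y = v + (k - 1) * p + q" by (auto simp: algebra_simps)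
    then show "(x, y) \<in> J" by (auto simp: J_def)
  next
    assume "(x, y) \<in> J"
    then obtain k where "x = v + k * p" "y = v + k * p + q" by (auto simp: J_def)
    then have "x + p = v + (k + 1) * p" "y + p = v + (k + 1) * p + q" by (auto simp: algebra_simps)
    then show "(x + p, y + p) \<in> J" by (auto simp: J_def)
  qed
  text \<open>The longest arc of \<open>P\<close> shields its left endpoint \<open>v\<close>, and its shift by \<open>q\<close> shields
    \<open>v + q\<close>: no arc of \<open>S0\<close> passes over either of them.\<close>
  have cover: "\<not> (x < v + k * p \<and> v + k * p < y) \<and> \<not> (x < v + k * p + q \<and> v + k * p + q < y)"
    if xy: "(x, y) \<in> S0" for x y k
  proof -
    have "P \<noteq> {}" using xy by (auto simp: S0_def)
    then have vP: "(v, v + m) \<in> P" using v by simp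
    have f: "(v + k * p, v + m + k * p) \<in> P" using periodic_mult[OF perP] vP by simp
    then have fS: "(v + k * p, v + m + k * p) \<in> S" "(v + k * p + q, v + m + k * p + q) \<in> S"
      by (auto simp: P_def paired_def)
    have xyS: "(x, y) \<in> S" using xy S0S by auto
    show ?thesis
      using arc_systemD(3)[OF S xyS fS(1)] arc_systemD(3)[OF S xyS fS(2)] len0[OF xy] by linarith
  qed
  \<comment> \<open>Distinct translates start at least \<open>p\<close> apart, which exceeds their
    span \<open>q\<close>, so the assumptions on \<open>x'\<close> are contradictory.\<close>
  have JJ: "y' \<le> y" if "(x, y) \<in> J" "(x', y') \<in> J" "x < x'" "x' < y" for x y x' y'
  proof -
    obtain k where k: "x = v + k * p" "y = v + k * p + q" using \<open>(x, y) \<in> J\<close> by (auto simp: J_def)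
    obtain l where l: "x' = v + l * p" using \<open>(x', y') \<in> J\<close> by (auto simp: J_def)
    have "k * p < l * p" using k l that by simp
    then have "k + 1 \<le> l" using q by simp
    then have "(k + 1) * p \<le> l * p" using q by (intro mult_right_mono) auto
    then show ?thesis using k l that q by (simp add: algebra_simps)
  qed
  have S1: "arc_system p S1"
    unfolding arc_system_def
  proof (intro conjI allI impI)
    fix x y assume "(x, y) \<in> S1" then show "x < y" using len0 q by (auto simp: S1_def J_def)
  next
    fix x y show "(x + p, y + p) \<in> S1 \<longleftrightarrow> (x, y) \<in> S1" using per0 perJ by (simp add: S1_def)
  next
    fix x y x' y' assume e: "(x, y) \<in> S1" and e': "(x', y') \<in> S1"
    show "\<not> (x < x' \<and> x' < y \<and> y < y')"
    proof
      assume lt: "x < x' \<and> x' < y \<and> y < y'"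
      consider "(x, y) \<in> S0" "(x', y') \<in> S0" | "(x, y) \<in> S0" "(x', y') \<in> J"
        | "(x, y) \<in> J" "(x', y') \<in> S0" | "(x, y) \<in> J" "(x', y') \<in> J"
        using e e' by (auto simp: S1_def)
      then show False
      proof cases
        case 1 then show False using arc_systemD(3)[OF S, of x y x' y'] S0S lt by auto
      next
        case 2 then show False using cover[OF 2(1)] lt by (auto simp: J_def)
      next
        case 3 then show False using cover[OF 3(2)] lt by (auto simp: J_def)
      next
        case 4 then show False using JJ[OF 4] lt by simp
      qed
    qed
  qed
  have PS1: "P \<subseteq> paired q S1" by (auto simp: paired_def S1_def S0_def)
  define S2 where "S2 = {(x, y). (x + v, y + v) \<in> S1}"
  have S2: "arc_system p S2" unfolding S2_def by (rule arc_system_translate[OF S1])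
  have "(v, v + q) \<in> J" by (auto simp: J_def intro!: exI[of _ 0])
  then have "(0, q) \<in> S2" by (simp add: S2_def S1_def add.commute)
  moreover have "card (window 0 p (paired q S)) \<le> card (window 0 p (paired q S2))"
  proof -
    have "(\<lambda>(x, y). (x - v, y - v)) ` window v p P \<subseteq> window 0 p (paired q S2)"
      using PS1 by (auto simp: window_def paired_def S2_def algebra_simps)
    moreover have "inj_on (\<lambda>(x, y). (x - v, y - v)) (window v p P)" by (auto simp: inj_on_def)
    ultimately have "card (window v p P) \<le> card (window 0 p (paired q S2))"
      using card_inj_on_le finite_window_paired[OF S2 q(1) qp] by blast
    then show ?thesis using card_window_paired[OF S q(1) qp, of v 0] by (simp add: P_def)
  qed
  ultimately show ?thesis using S2 by blast
qed

subsection \<open>Comparison with the Euclidean algorithm\<close>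

lemma euclid_subtractions_less:
  assumes "0 < q" "q < p"
  shows "euclid_subtractions p q = Suc (euclid_subtractions (p - q) q)"
proof -
  obtain p' q' where "p = Suc p'" "q = Suc q'" using assms by (metis less_imp_Suc_add gr0_conv_Suc)
  then show ?thesis using assms by simp
qed

lemma euclid_subtractions_commute: "euclid_subtractions p q = euclid_subtractions q p"
proof (induction p q rule: euclid_subtractions.induct)
  case (1 q)
  then show ?case by (cases q) auto
next
  case (3 p q)
  then show ?case by (cases p q rule: linorder_cases) (auto simp del: diff_Suc_Suc)
qed simp

text \<open>One subtraction turns either pair into the unordered pair of \<open>q\<close> and
  \<open>p - q\<close>.\<close>

lemma euclid_subtractions_complement:
  assumes "0 < q" "q < p"
  shows "euclid_subtractions p (p - q) = euclid_subtractions p q"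
  using euclid_subtractions_less[of q p] euclid_subtractions_less[of "p - q" p]
    euclid_subtractions_commute[of q "p - q"] assms by simp

lemma euclid_subtractions_1: "euclid_subtractions p 1 = p"
proof (induction p)
  case (Suc p)
  then show ?case using euclid_subtractions_less[of 1 "Suc p"] by (cases "p = 0") auto
qed simp

text \<open>For \<open>2 * q < p\<close> and \<open>q > 1\<close>, inserting and collapsing an arc
  leads to \<open>(p - q, q)\<close>, and \<open>2 * q - 1\<close> plus \<open>2 * (p - q)\<close>
  is one less than \<open>2 * p\<close>, which pays for one subtraction. For \<open>q = 1\<close>
  paired arcs have length one, so there are at most \<open>p\<close> of them, and the Euclidean
  count is \<open>p\<close>. For \<open>2 * q > p\<close> one passes to
  \<open>p - q\<close>.\<close>

lemma card_paired_bound: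
  fixes p q :: nat
  assumes "0 < q" "q < p" "coprime p q" "arc_system (int p) S"
  shows "card (window 0 (int p) (paired (int q) S)) + euclid_subtractions p q \<le> 2 * p"
  using assms
proof (induction p arbitrary: q S rule: less_induct)
  case (less p)
  have main: "card (window 0 (int p) (paired (int q) S)) + euclid_subtractions p q \<le> 2 * p"
    if q: "0 < q" "2 * q \<le> p" and cop: "coprime p q" for q
  proof (cases "q = 1")
    case True
    have "window 0 (int p) (paired (int q) S) \<subseteq> (\<lambda>x. (x, x + 1)) ` {0..<int p}"
    proof (clarsimp simp: window_def)
      fix x y assume "(x, y) \<in> paired (int q) S" "0 \<le> x" "x < int p"
      then show "(x, y) \<in> (\<lambda>x. (x, x + 1)) ` {0..<int p}"
        using paired_length[OF less.prems(4), of q x y] less.prems q True by force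
    qed
    then have "card (window 0 (int p) (paired (int q) S)) \<le> p"
      using surj_card_le[of "{0..<int p}"] by fastforce
    then show ?thesis using True euclid_subtractions_1 by simp
  next
    case False
    have "2 * q \<noteq> p" using cop False by auto
    then have q': "0 < int q" "2 * int q < int p" using q by auto
    obtain S1 where S1: "arc_system (int p) S1" "(0, int q) \<in> S1"
      and c1: "card (window 0 (int p) (paired q S)) \<le> card (window 0 (int p) (paired q S1))"
      using arc_system_add_arc[OF less.prems(4) q'] by blast
    obtain S2 where S2: "arc_system (int p - int q) S2" and c2:
      "int (card (window 0 p (paired q S1))) \<le> 2 * int q - 1 + int (card (window 0 (int p - int q) (paired q S2)))"
      using paired_collapse_step[OF S1(1) q' S1(2)] by blast
    have "coprime (p - q) q" using cop q gcd_diff1_nat[of q p] by (simp add: coprime_iff_gcd_eq_1)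
    moreover have "arc_system (int (p - q)) S2" using S2 q by (simp add: of_nat_diff)
    ultimately have "card (window 0 (int (p - q)) (paired (int q) S2)) + euclid_subtractions (p - q) q \<le> 2 * (p - q)"
      using less.IH[of "p - q" q S2] q q' by simp
    then show ?thesis using c1 c2 euclid_subtractions_less[of q p] q by (simp add: of_nat_diff)
  qed
  show ?case
  proof (cases "2 * q \<le> p")
    case True
    then show ?thesis using main[of q] less.prems by simp
  next
    case False
    have "coprime p (p - q)"
      using less.prems gcd_diff1_nat[of q p] gcd_add2[of "p - q" q]
      by (simp add: coprime_iff_gcd_eq_1 gcd.commute)
    then have "card (window 0 (int p) (paired (int (p - q)) S)) + euclid_subtractions p (p - q) \<le> 2 * p"
      using main[of "p - q"] less.prems False by simp
    then show ?thesis
      using card_paired_complement[OF less.prems(4), of "int q"]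
        euclid_subtractions_complement[of q p] less.prems
      by (simp add: of_nat_diff)
  qed
qed

subsection \<open>Vertices and chords of the regular polygon\<close>

text \<open>Indices range over all integers, so that rotation is an index shift and chords lift to
  periodic arcs.\<close>

definition vertex :: "complex \<Rightarrow> complex \<Rightarrow> nat \<Rightarrow> int \<Rightarrow> complex" where
  "vertex c a p k = c + a * cis (2 * pi * real_of_int k / real p)"

text \<open>Twice the signed area of the triangle \<open>A\<close>, \<open>B\<close>,
  \<open>z\<close>: positive exactly when \<open>z\<close> is to the left of the directed line from
  \<open>A\<close> to \<open>B\<close>.\<close>

definition orient :: "complex \<Rightarrow> complex \<Rightarrow> complex \<Rightarrow> real" where
  "orient A B z = Im (cnj (B - A) * (z - A))"

lemma orient_segment: "orient A B ((1 - u) *\<^sub>R z + u *\<^sub>R w) = (1 - u) * orient A B z + u * orient A B w"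
  by (simp add: orient_def algebra_simps)

lemma orient_right [simp]: "orient A B B = 0"
  by (simp add: orient_def algebra_simps)

lemma orient_left [simp]: "orient A B A = 0"
  by (simp add: orient_def)

lemma crossing_segments:
  assumes "orient A B C < 0" "0 < orient A B D" "0 < orient C D A" "orient C D B < 0"
  shows "open_segment A B \<inter> open_segment C D \<noteq> {}"
proof -
  \<comment> \<open>Both differences of orientations equal the cross product of \<open>B - A\<close>
    and \<open>D - C\<close>. So the zeros of \<open>orient C D\<close> along \<open>AB\<close> and
    of \<open>orient A B\<close> along \<open>CD\<close> have parameters \<open>r\<close> and
    \<open>s\<close> with the common denominator \<open>\<Delta>\<close>.\<close>
  define \<Delta> where "\<Delta> = orient A B D - orient A B C"
  have \<Delta>: "\<Delta> > 0" "\<Delta> = orient C D A - orient C D B"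
    using assms by (simp_all add: \<Delta>_def) (simp add: orient_def algebra_simps)
  define r s where "r = orient C D A / \<Delta>" and "s = - orient A B C / \<Delta>"
  have r: "0 < r" "r < 1" using assms \<Delta> by (simp_all add: r_def)
  have s: "0 < s" "s < 1" using assms by (simp_all add: s_def \<Delta>_def field_simps)
  define z where "z = (1 - r) *\<^sub>R A + r *\<^sub>R B"
  have "of_real \<Delta> * A + of_real (orient C D A) * (B - A) = of_real \<Delta> * C - of_real (orient A B C) * (D - C)"
    unfolding \<Delta>_def by (simp add: complex_eq_iff orient_def algebra_simps)
  then have "A + of_real r * (B - A) = C + of_real s * (D - C)"
    using \<Delta>(1) by (simp add: r_def s_def field_simps)
  then have "z = (1 - s) *\<^sub>R C + s *\<^sub>R D"
    by (simp add: z_def scaleR_conv_of_real algebra_simps)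
  moreover have "A \<noteq> B" "C \<noteq> D" using assms by (auto simp: orient_def)
  ultimately have "z \<in> open_segment A B" "z \<in> open_segment C D"
    unfolding in_segment z_def using r s by blast+
  then show ?thesis by blast
qed

lemma cis_diff: "cis x - cis y = 2 * \<i> * of_real (sin ((x - y) / 2)) * cis ((x + y) / 2)"
proof -
  have "cis x = cis ((x + y) / 2) * cis ((x - y) / 2)" "cis y = cis ((x + y) / 2) * cis (- ((x - y) / 2))"
    by (simp_all add: cis_mult field_simps)
  moreover have "cis t - cis (- t) = 2 * \<i> * of_real (sin t)" for t
    by (simp add: complex_eq_iff)
  ultimately show ?thesis by (metis (no_types, lifting) mult.commute right_diff_distrib)
qed

lemma vertex_diff:
  "vertex c a p j - vertex c a p i =
     2 * \<i> * a * of_real (sin (pi * of_int (j - i) / p)) * cis (pi * of_int (i + j) / p)"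
proof -
  have "vertex c a p j - vertex c a p i = a * (cis (2 * pi * of_int j / p) - cis (2 * pi * of_int i / p))"
    by (simp add: vertex_def right_diff_distrib)
  also have "\<dots> = a * (2 * \<i> * of_real (sin (pi * of_int (j - i) / p)) * cis (pi * of_int (i + j) / p))"
    unfolding cis_diff by (simp add: field_simps diff_divide_distrib add_divide_distrib)
  finally show ?thesis by (simp add: mult_ac)
qed

text \<open>By \<open>vertex_diff\<close> each chord is a real sine times a rotation, up to a common
  factor; multiplying one chord at \<open>i\<close> by the conjugate of the other leaves the
  inscribed angle over the third side. Hence the signs of three sines decide the
  orientation.\<close>

lemma orient_vertex:
  "orient (vertex c a p i) (vertex c a p j) (vertex c a p k) =
     4 * (cmod a)\<^sup>2 * sin (pi * of_int (j - i) / p) * sin (pi * of_int (k - i) / p) * sin (pi * of_int (k - j) / p)"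
proof -
  let ?s = "\<lambda>x::int. sin (pi * of_int x / p)"
  have "cnj (cis (pi * of_int (i + j) / p)) * cis (pi * of_int (i + k) / p) = cis (pi * of_int (k - j) / p)"
    by (simp add: cis_cnj cis_mult flip: diff_divide_distrib) (simp add: field_simps)
  then have "cnj (vertex c a p j - vertex c a p i) * (vertex c a p k - vertex c a p i) =
      of_real (4 * ?s (j - i) * ?s (k - i)) * (cnj a * a) * cis (pi * of_int (k - j) / p)"
    unfolding vertex_diff by (auto simp: mult_ac)
  also have "cnj a * a = of_real ((cmod a)\<^sup>2)" by (metis complex_norm_square mult.commute)
  finally show ?thesis by (simp add: orient_def)
qed

lemma sin_pos_int:
  fixes d :: int
  assumes "0 < d" "d < int p"
  shows "0 < sin (pi * of_int d / p)"
proof (rule sin_gt_zero)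
  show "0 < pi * of_int d / p" using assms by simp
  have "real_of_int d < real p" using assms by linarith
  then show "pi * of_int d / p < pi" using assms by (simp add: field_simps)
qed

lemma sin_neg_int:
  fixes d :: int
  assumes "- int p < d" "d < 0"
  shows "sin (pi * of_int d / p) < 0"
  using sin_pos_int[of "- d" p] assms by simp

lemma orient_vertex_neg:
  assumes "a \<noteq> 0" "i < k" "k < j" "j < i + int p"
  shows "orient (vertex c a p i) (vertex c a p j) (vertex c a p k) < 0"
  unfolding orient_vertex
  using sin_pos_int[of "j - i" p] sin_pos_int[of "k - i" p] sin_neg_int[of p "k - j"] assms
  by (intro mult_pos_neg mult_pos_pos) auto

lemma orient_vertex_pos:
  assumes "a \<noteq> 0" "i < j" "j < k" "k < i + int p"
  shows "0 < orient (vertex c a p i) (vertex c a p j) (vertex c a p k)"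
  unfolding orient_vertex
  using sin_pos_int[of "j - i" p] sin_pos_int[of "k - i" p] sin_pos_int[of "k - j" p] assms
  by (intro mult_pos_pos) auto

lemma orient_cyclic: "orient A B C = orient B C A"
  by (simp add: orient_def algebra_simps)

lemma crossing_chords:
  assumes "a \<noteq> 0" "i < k" "k < j" "j < l" "l < i + int p"
  shows "open_segment (vertex c a p i) (vertex c a p j) \<inter> open_segment (vertex c a p k) (vertex c a p l) \<noteq> {}"
proof (rule crossing_segments)
  show "0 < orient (vertex c a p k) (vertex c a p l) (vertex c a p i)"
    using orient_vertex_pos[of a i k l p c] assms by (subst orient_cyclic[symmetric]) auto
qed (use assms in \<open>auto intro: orient_vertex_neg orient_vertex_pos\<close>)

lemma vertex_inj:
  assumes "a \<noteq> 0" "i < j" "j < i + int p"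
  shows "vertex c a p i \<noteq> vertex c a p j"
  using vertex_diff[of c a p j i] sin_pos_int[of "j - i" p] assms by auto

lemma vertex_add_period [simp]:
  assumes "0 < p"
  shows "vertex c a p (k + int p) = vertex c a p k"
proof -
  have "cis (2 * pi * of_int (k + int p) / p) = cis (2 * pi * of_int k / p + 2 * pi)"
    using assms by (simp add: field_simps)
  also have "\<dots> = cis (2 * pi * of_int k / p)" by (simp add: complex_eq_iff)
  finally show ?thesis by (simp add: vertex_def)
qed

lemma vertex_add_multiple:
  assumes "0 < p"
  shows "vertex c a p (k + m * int p) = vertex c a p k"
proof (induction m rule: int_induct[where k = 0])
  case (step1 i)
  then show ?case using vertex_add_period[OF assms, of c a "k + i * int p"] by (simp add: algebra_simps)
next
  case (step2 i)
  then show ?case using vertex_add_period[OF assms, of c a "k + (i - 1) * int p"] by (simp add: algebra_simps)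
qed simp

lemma vertex_window:
  assumes "0 < p"
  obtains l where "m \<le> l" "l < m + int p" "vertex c a p l = vertex c a p k"
proof
  show "vertex c a p (m + (k - m) mod int p) = vertex c a p k"
    using vertex_add_multiple[OF assms, of c a "k" "- ((k - m) div int p)"]
      div_mult_mod_eq[of "k - m" "int p"]
    by (simp add: algebra_simps minus_div_mult_eq_mod[symmetric])
qed (use assms in auto)

lemma regular_polygon_vertices_eq:
  assumes "0 < p"
  shows "regular_polygon_vertices c a p = range (vertex c a p)"
proof
  show "regular_polygon_vertices c a p \<subseteq> range (vertex c a p)"
  proof
    fix u assume "u \<in> regular_polygon_vertices c a p"
    then obtain n :: nat where "u = vertex c a p (int n)"
      by (auto simp: regular_polygon_vertices_def vertex_def)
    then show "u \<in> range (vertex c a p)" by simp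
  qed
  show "range (vertex c a p) \<subseteq> regular_polygon_vertices c a p"
  proof clarify
    fix k
    obtain l where l: "0 \<le> l" "l < int p" "vertex c a p l = vertex c a p k"
      by (rule vertex_window[OF assms, of 0 c a k]) auto
    have "vertex c a p l = c + a * cis (2 * pi * real (nat l) / real p)" using l by (simp add: vertex_def)
    moreover have "nat l < p" using l assms by linarith
    ultimately show "vertex c a p k \<in> regular_polygon_vertices c a p"
      unfolding regular_polygon_vertices_def l(3)[symmetric] by (intro image_eqI[of _ _ "nat l"]) auto
  qed
qed

lemma rotate_about_vertex:
  "rotate_about c (2 * pi * real q / real p) (vertex c a p k) = vertex c a p (k + int q)"
  by (simp add: rotate_about_def vertex_def cis_mult add_divide_distrib distrib_left add.commute mult.left_commute)

lemma rotate_about_inj: "inj (rotate_about c \<theta>)"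
  by (auto simp: inj_def rotate_about_def)

subsection \<open>Triangulations and flips\<close>

text \<open>For distinct vertices this says that they span a side of a triangle of \<open>T\<close>,
  because a triangle contains no polygon vertices besides its corners.\<close>

definition linked :: "complex \<Rightarrow> complex \<Rightarrow> nat \<Rightarrow> complex set set \<Rightarrow> int \<Rightarrow> int \<Rightarrow> bool" where
  "linked c a p T i j \<longleftrightarrow> (\<exists>t\<in>T. vertex c a p i \<in> t \<and> vertex c a p j \<in> t)"

lemma linked_commute: "linked c a p T i j \<longleftrightarrow> linked c a p T j i"
  by (auto simp: linked_def)

text \<open>A polygon vertex in \<open>t\<close> is an extreme point of some member
  \<open>t'\<close>. As \<open>t \<inter> t'\<close> is a face of both, extremality passes from
  \<open>t'\<close> to the intersection and from there to \<open>t\<close>.\<close>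

lemma triangle_corners:
  assumes T: "polygon_triangulation c a p T" and t: "t \<in> T"
  obtains C where "card C = 3" "t = convex hull C" "t \<inter> regular_polygon_vertices c a p = C"
    "\<And>x. x extreme_point_of t \<longleftrightarrow> x \<in> C"
proof -
  let ?V = "regular_polygon_vertices c a p"
  have "2 simplex t" using T t by (simp add: polygon_triangulation_def)
  then obtain C where C: "\<not> affine_dependent C" "int (card C) = 2 + 1" "t = convex hull C"
    unfolding simplex_def by blast
  have ext: "x extreme_point_of t \<longleftrightarrow> x \<in> C" for x
    using extreme_point_of_convex_hull_affine_independent[OF C(1)] C(3) by simp
  have V: "{v. \<exists>t\<in>T. v extreme_point_of t} = ?V" using T by (simp add: polygon_triangulation_def)
  have "C \<subseteq> ?V" unfolding V[symmetric] using ext t by blast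
  moreover have "C \<subseteq> t" unfolding C(3) by (rule hull_subset)
  moreover have "u \<in> C" if u: "u \<in> t" "u \<in> ?V" for u
  proof -
    obtain t' where t': "t' \<in> T" "u extreme_point_of t'" using u(2) unfolding V[symmetric] by blast
    have f: "(t \<inter> t') face_of t" "(t' \<inter> t) face_of t'"
      using T t t'(1) unfolding polygon_triangulation_def triangulation_def by blast+
    have "u \<in> t \<inter> t'" using u(1) t'(2) by (simp add: extreme_point_of_def)
    then have "u extreme_point_of t"
      using extreme_point_of_face[OF f(1), of u] extreme_point_of_face[OF f(2), of u] t'(2)
      by (simp add: Int_commute)
    then show ?thesis using ext by simp
  qed
  ultimately have "t \<inter> ?V = C" by blast
  then show ?thesis using that[of C] C ext by simp
qed

lemma face_of_triangulation_segment:
  assumes T: "polygon_triangulation c a p T" and t: "t \<in> T" "t' \<in> T"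
    and "u \<in> t" "w \<in> t" "z \<in> t'" "z \<in> open_segment u w"
  shows "u \<in> t'" "w \<in> t'"
proof -
  have f: "(t \<inter> t') face_of t"
    using T t unfolding polygon_triangulation_def triangulation_def by blast
  have "convex t" by (rule triangle_corners[OF T t(1)]) simp
  then have "z \<in> t" using assms(4,5,7) unfolding convex_contains_open_segment by blast
  then have "u \<in> t \<inter> t' \<and> w \<in> t \<inter> t'" using f assms(4-7) unfolding face_of_def by blast
  then show "u \<in> t'" "w \<in> t'" by auto
qed

section \<open>Links between vertices of a triangulated polygon\<close>

locale regular_polygon =
  fixes c a :: complex and p :: nat
  assumes a: "a \<noteq> 0" and p: "3 \<le> p"
begin

abbreviation "v \<equiv> vertex c a p"
abbreviation "link \<equiv> linked c a p"

lemma vertices: "regular_polygon_vertices c a p = range v"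
  using regular_polygon_vertices_eq p by simp

lemma vertex_neq: "i < j \<Longrightarrow> j < i + int p \<Longrightarrow> v i \<noteq> v j"
  using vertex_inj a by blast

lemma link_period: "link T (i + int p) j \<longleftrightarrow> link T i j" "link T i (j + int p) \<longleftrightarrow> link T i j"
  using p by (auto simp: linked_def)

text \<open>Two crossing chords meet in a point common to their triangles. The face property then
  forces the ends of the first chord into the triangle of the second, which would have four
  corners.\<close>

lemma link_noncrossing:
  assumes T: "polygon_triangulation c a p T" and "link T i j" "link T k l"
    and lt: "i < k" "k < j" "j < l" "l < i + int p"
  shows False
proof -
  obtain t where t: "t \<in> T" "v i \<in> t" "v j \<in> t" using assms(2) by (auto simp: linked_def)
  obtain t' where t': "t' \<in> T" "v k \<in> t'" "v l \<in> t'" using assms(3) by (auto simp: linked_def)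
  obtain z where z: "z \<in> open_segment (v i) (v j)" "z \<in> open_segment (v k) (v l)"
    using crossing_chords[OF a lt] by blast
  obtain C where C: "card C = 3" "t' = convex hull C" "t' \<inter> regular_polygon_vertices c a p = C"
    by (rule triangle_corners[OF T t'(1)]) blast
  have "convex t'" using C(2) by simp
  then have "z \<in> t'" using t' z(2) unfolding convex_contains_open_segment by blast
  then have "v i \<in> t'" "v j \<in> t'"
    using face_of_triangulation_segment[OF T t(1) t'(1) t(2,3) _ z(1)] by auto
  then have "{v i, v k, v j, v l} \<subseteq> C" using t' C(3) vertices by auto
  moreover have "card {v i, v k, v j, v l} = 4"
    using vertex_neq[of i k] vertex_neq[of i j] vertex_neq[of i l] vertex_neq[of k j]
      vertex_neq[of k l] vertex_neq[of j l] lt by auto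
  moreover have "finite C" using C(1) by (intro card_ge_0_finite) simp
  ultimately show False using C(1) card_mono[of C "{v i, v k, v j, v l}"] by linarith
qed

text \<open>A triangle is the hull of its corners. If none lay strictly between \<open>i\<close> and
  \<open>j\<close>, all of them, and hence \<open>z\<close>, would lie in the closed half-plane on
  the other side of the chord.\<close>

lemma triangle_cap:
  assumes T: "polygon_triangulation c a p T" and t: "t \<in> T" "z \<in> t"
    and ij: "i < j" "j < i + int p" and z: "orient (v i) (v j) z < 0"
  shows "\<exists>k. i < k \<and> k < j \<and> v k \<in> t"
proof (rule ccontr)
  assume none: "\<not> ?thesis"
  obtain C where C: "t = convex hull C" "t \<inter> regular_polygon_vertices c a p = C"
    by (rule triangle_corners[OF T t(1)]) blast
  define H where "H = {w. 0 \<le> orient (v i) (v j) w}"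
  have "convex H"
    unfolding convex_alt H_def mem_Collect_eq orient_segment
    by (intro ballI allI impI add_nonneg_nonneg mult_nonneg_nonneg) auto
  moreover have "C \<subseteq> H"
  proof
    fix x assume x: "x \<in> C"
    then have "x \<in> t" "x \<in> range v" unfolding C(2)[symmetric] vertices by simp_all
    then obtain k where k: "x = v k" "v k \<in> t" by blast
    obtain l where l: "i \<le> l" "l < i + int p" "v l = v k"
      by (rule vertex_window[of p i c a k]) (use p in auto)
    have "\<not> (i < l \<and> l < j)" using none l(3) k(2) by metis
    then consider "l = i" | "l = j" | "j < l" using l(1) by linarith
    then have "0 \<le> orient (v i) (v j) (v l)"
    proof cases
      case 3
      then show ?thesis using orient_vertex_pos[of a i j l p c] a ij l(2) by simp
    qed simp_all
    then show "x \<in> H" using k(1) l(3) by (simp add: H_def)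
  qed
  ultimately have "t \<subseteq> H" using C(1) by (simp add: hull_minimal)
  then show False using t(2) z by (auto simp: H_def)
qed

lemma segment_in_Union:
  assumes T: "polygon_triangulation c a p T" and "0 \<le> u" "u \<le> 1"
    and z: "z \<in> \<Union>T" and w: "w \<in> \<Union>T"
  shows "(1 - u) *\<^sub>R z + u *\<^sub>R w \<in> \<Union>T"
proof -
  have "\<Union>T = convex hull (regular_polygon_vertices c a p)"
    using T by (simp add: polygon_triangulation_def)
  then have "convex (\<Union>T)" by simp
  then show ?thesis using z w assms(2,3) unfolding convex_alt by blast
qed

lemma vertex_in_Union:
  assumes T: "polygon_triangulation c a p T"
  shows "v k \<in> \<Union>T"
proof -
  have "\<Union>T = convex hull (regular_polygon_vertices c a p)"
    using T by (simp add: polygon_triangulation_def)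
  moreover have "v k \<in> convex hull (regular_polygon_vertices c a p)"
    by (rule hull_inc) (simp add: vertices)
  ultimately show ?thesis by simp
qed

text \<open>The midpoint of the side lies in some triangle. It is cut off by the chord from
  \<open>i - 1\<close> to \<open>i + 1\<close>, beyond which \<open>i\<close> is the only vertex,
  and likewise by the chord from \<open>i\<close> to \<open>i + 2\<close>; so both ends are
  corners.\<close>

lemma link_side:
  assumes T: "polygon_triangulation c a p T"
  shows "link T i (i + 1)"
proof -
  define m where "m = (1 - 1/2) *\<^sub>R v i + (1/2) *\<^sub>R v (i + 1)"
  have "m \<in> \<Union>T" unfolding m_def
    by (rule segment_in_Union[OF T _ _ vertex_in_Union[OF T] vertex_in_Union[OF T]]) simp_all
  then obtain t where t: "t \<in> T" "m \<in> t" by blast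
  have "orient (v (i - 1)) (v (i + 1)) m < 0"
    unfolding m_def orient_segment using orient_vertex_neg[of a "i - 1" i "i + 1" p c] a p by simp
  then obtain k where k: "i - 1 < k" "k < i + 1" "v k \<in> t"
    using triangle_cap[OF T t, of "i - 1" "i + 1"] p by auto
  then have "k = i" by simp
  then have "v i \<in> t" using k(3) by simp
  have "orient (v i) (v (i + 2)) m < 0"
    unfolding m_def orient_segment using orient_vertex_neg[of a i "i + 1" "i + 2" p c] a p by simp
  then obtain k where k: "i < k" "k < i + 2" "v k \<in> t"
    using triangle_cap[OF T t, of i "i + 2"] p by auto
  then have "k = i + 1" by simp
  then show ?thesis unfolding linked_def using \<open>v i \<in> t\<close> k(3) t(1) by blast
qed

text \<open>A point \<open>z\<close> just beyond the midpoint \<open>m\<close> of the chord lies in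
  a triangle that also contains \<open>m\<close>. By \<open>triangle_cap\<close> it has a corner
  beyond the chord, and by the face property it contains both ends of the chord.\<close>

lemma link_apex:
  assumes T: "polygon_triangulation c a p T" and ij: "link T i j" "i + 2 \<le> j" "j < i + int p"
  shows "\<exists>k. i < k \<and> k < j \<and> link T i k \<and> link T k j"
proof -
  obtain t0 where t0: "t0 \<in> T" "v i \<in> t0" "v j \<in> t0" using ij(1) by (auto simp: linked_def)
  define m where "m = (1 - 1/2) *\<^sub>R v i + (1/2) *\<^sub>R v j"
  define w where "w = v (i + 1)"
  have m: "m \<in> open_segment (v i) (v j)"
    using vertex_neq[of i j] ij by (auto simp: in_segment m_def intro!: exI[of _ "1/2"])
  have mT: "m \<in> \<Union>T" unfolding m_def
    by (rule segment_in_Union[OF T _ _ vertex_in_Union[OF T] vertex_in_Union[OF T]]) simp_all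
  have "orient (v i) (v j) w < 0"
    unfolding w_def using orient_vertex_neg[of a i "i + 1" j p c] a ij by simp
  define U where "U = \<Union>{t \<in> T. m \<notin> t}"
  have "closed U"
    unfolding U_def
  proof (rule closed_Union)
    show "finite {t \<in> T. m \<notin> t}"
      using T by (simp add: polygon_triangulation_def triangulation_def)
    show "\<forall>t\<in>{t \<in> T. m \<notin> t}. closed t"
    proof
      fix t assume "t \<in> {t \<in> T. m \<notin> t}"
      then have "t \<in> T" by simp
      then obtain C where C: "card C = 3" "t = convex hull C"
        by (rule triangle_corners[OF T]) blast
      have "finite C" using C(1) by (intro card_ge_0_finite) simp
      then show "closed t" using C(2) by (simp add: finite_imp_compact_convex_hull compact_imp_closed)
    qed
  qed
  moreover have "m \<notin> U" by (auto simp: U_def)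
  ultimately obtain e where e: "0 < e" "ball m e \<subseteq> - U"
    using open_contains_ball[of "- U"] by (auto simp: open_Compl)
  \<comment> \<open>So small that \<open>z\<close> stays in the ball around \<open>m\<close> that
    avoids every triangle missing \<open>m\<close>; the cap \<open>1\<close> keeps \<open>z\<close>
    on the segment from \<open>m\<close> to \<open>w\<close>.\<close>
  define u where "u = min 1 (e / (2 * (1 + norm (w - m))))"
  have pos: "0 < 1 + norm (w - m)" by (simp add: add_pos_nonneg)
  have u: "0 < u" "u \<le> 1" using e(1) pos by (auto simp: u_def)
  define z where "z = (1 - u) *\<^sub>R m + u *\<^sub>R w"
  have "z - m = u *\<^sub>R (w - m)" by (simp add: z_def algebra_simps)
  then have "norm (z - m) = u * norm (w - m)" using u by simp
  also have "\<dots> \<le> e / (2 * (1 + norm (w - m))) * norm (w - m)"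
    by (rule mult_right_mono) (auto simp: u_def)
  also have "\<dots> < e"
  proof -
    have "norm (w - m) < 2 * (1 + norm (w - m))" by (simp add: distrib_left) (use norm_ge_zero[of "w - m"] in linarith)
    then show ?thesis using e(1) pos by (simp add: divide_less_eq)
  qed
  finally have "z \<in> ball m e" by (simp add: dist_norm norm_minus_commute)
  then have "z \<notin> U" using e(2) by blast
  moreover have "z \<in> \<Union>T" unfolding z_def w_def
    by (rule segment_in_Union[OF T _ _ mT vertex_in_Union[OF T]]) (use u in auto)
  ultimately obtain t where t: "t \<in> T" "z \<in> t" "m \<in> t" unfolding U_def by blast
  have "orient (v i) (v j) m = 0" unfolding m_def orient_segment by simp
  then have "orient (v i) (v j) z < 0"
    unfolding z_def orient_segment using \<open>orient (v i) (v j) w < 0\<close> u by (simp add: mult_pos_neg)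
  then obtain k where k: "i < k" "k < j" "v k \<in> t"
    using triangle_cap[OF T t(1,2), of i j] ij by auto
  have "v i \<in> t" "v j \<in> t"
    using face_of_triangulation_segment[OF T t0(1) t(1) t0(2,3) t(3) m] by auto
  then show ?thesis using k t(1) by (auto simp: linked_def)
qed

text \<open>The apex \<open>k\<close> splits the links below \<open>(i, j)\<close> into two disjoint
  families, and \<open>(i, j)\<close> itself adds one:
  \<open>(2 * (k - i) - 1) + (2 * (j - k) - 1) + 1\<close>.\<close>

lemma card_link_ge:
  assumes T: "polygon_triangulation c a p T" and "link T i j" "i < j" "j < i + int p"
  shows "2 * (j - i) - 1 \<le> int (card {(x, y). i \<le> x \<and> x < y \<and> y \<le> j \<and> link T x y})"
  using assms(2-)
proof (induction "nat (j - i)" arbitrary: i j rule: less_induct)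
  case less
  define E where "E = (\<lambda>i j. {(x, y). i \<le> x \<and> x < y \<and> y \<le> j \<and> link T x y})"
  have fin: "finite (E i j)" for i j
    by (rule finite_subset[of _ "{i..j} \<times> {i..j}"]) (auto simp: E_def)
  have ij: "(i, j) \<in> E i j" using less.prems by (simp add: E_def)
  show ?case
  proof (cases "i + 2 \<le> j")
    case False
    then have "j = i + 1" using less.prems by simp
    moreover have "0 < card (E i j)" using ij fin card_gt_0_iff by blast
    ultimately show ?thesis by (simp add: E_def)
  next
    case True
    then obtain k where k: "i < k" "k < j" "link T i k" "link T k j"
      using link_apex[OF T less.prems(1)] less.prems by blast
    have "2 * (k - i) - 1 \<le> int (card (E i k))" "2 * (j - k) - 1 \<le> int (card (E k j))"
      unfolding E_def using less.hyps[of k i] less.hyps[of j k] k less.prems by auto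
    moreover have "card (insert (i, j) (E i k \<union> E k j)) \<le> card (E i j)"
      by (rule card_mono[OF fin]) (use ij k in \<open>auto simp: E_def\<close>)
    moreover have "card (insert (i, j) (E i k \<union> E k j)) = Suc (card (E i k) + card (E k j))"
    proof -
      have "(i, j) \<notin> E i k \<union> E k j" "E i k \<inter> E k j = {}" using k by (auto simp: E_def)
      then show ?thesis using fin by (simp add: card_Un_disjoint)
    qed
    ultimately show ?thesis by (simp add: E_def algebra_simps)
  qed
qed

section \<open>Counting chords and the effect of flips\<close>

definition edges :: "complex set set \<Rightarrow> (int \<times> int) set" where
  "edges T = {(x, y). 0 \<le> x \<and> x < y \<and> y < int p \<and> link T x y}"

lemma finite_edges: "finite (edges T)"
  by (rule finite_subset[of _ "{0..<int p} \<times> {0..<int p}"]) (auto simp: edges_def)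

lemma card_edges_ge:
  assumes T: "polygon_triangulation c a p T"
  shows "2 * p \<le> card (edges T) + 3"
proof -
  \<comment> \<open>The side joining the last vertex to vertex \<open>0\<close> serves as the base
    chord, above all others.\<close>
  have "link T (-1 + int p) 0" using link_side[OF T, of "-1"] link_period(1)[of T "-1" 0] by simp
  then have "link T 0 (int p - 1)" by (subst linked_commute) simp
  then have "2 * (int p - 1) - 1 \<le> int (card {(x, y). 0 \<le> x \<and> x < y \<and> y \<le> int p - 1 \<and> link T x y})"
    using card_link_ge[OF T, of 0 "int p - 1"] p by simp
  also have "{(x, y). 0 \<le> x \<and> x < y \<and> y \<le> int p - 1 \<and> link T x y} = edges T"
    by (auto simp: edges_def)
  finally show ?thesis by simp
qed

lemma vertex_in_hull_corners:
  assumes T: "polygon_triangulation c a p T" and "convex hull S \<in> T" "v k \<in> convex hull S"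
  shows "v k \<in> S"
proof -
  obtain C where "convex hull S \<inter> regular_polygon_vertices c a p = C"
    "\<And>x. x extreme_point_of (convex hull S) \<longleftrightarrow> x \<in> C"
    by (rule triangle_corners[OF T assms(2)]) blast
  then have "v k extreme_point_of (convex hull S)" using assms(3) vertices by blast
  then show ?thesis by (rule extreme_point_of_convex_hull)
qed

text \<open>A lost chord joins two corners of a removed triangle that do not occur together in a new
  one. All pairs of corners except \<open>A\<close>, \<open>C\<close> recur in the new
  triangles.\<close>

lemma card_edges_flip:
  assumes "flip c a p T T'"
  shows "card (edges T - edges T') \<le> 1"
proof -
  have T: "polygon_triangulation c a p T"
    using assms unfolding flip_def by (rule conjunct1)
  obtain A B C D where "B \<noteq> D \<and> convex hull {A, B, C} \<in> T \<and> convex hull {A, C, D} \<in> T \<and>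
      T' = (T - {convex hull {A, B, C}, convex hull {A, C, D}})
               \<union> {convex hull {B, C, D}, convex hull {A, B, D}}"
    using assms[unfolded flip_def, THEN conjunct2, THEN conjunct2] by (elim exE) (rule that)
  then have t: "convex hull {A, B, C} \<in> T" "convex hull {A, C, D} \<in> T"
    and T': "T' = (T - {convex hull {A, B, C}, convex hull {A, C, D}})
               \<union> {convex hull {B, C, D}, convex hull {A, B, D}}"
    by blast+
  have t': "convex hull {B, C, D} \<in> T'" "convex hull {A, B, D} \<in> T'"
    unfolding T' by simp_all
  have key: "{v x, v y} = {A, C}" if xy: "(x, y) \<in> edges T - edges T'" for x y
  proof -
    have x: "0 \<le> x" "x < y" "y < int p" and l: "link T x y" and nl: "\<not> link T' x y"
      using xy by (auto simp: edges_def)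
    have ne: "v x \<noteq> v y" using vertex_neq[of x y] x by simp
    obtain s where s: "s \<in> T" "v x \<in> s" "v y \<in> s" using l by (auto simp: linked_def)
    have "s \<notin> T'" using nl s by (auto simp: linked_def)
    then have "s \<in> {convex hull {A, B, C}, convex hull {A, C, D}}" using s(1) unfolding T' by simp
    then have "v x \<in> {A, B, C} \<and> v y \<in> {A, B, C} \<or> v x \<in> {A, C, D} \<and> v y \<in> {A, C, D}"
      using vertex_in_hull_corners[OF T t(1), of x] vertex_in_hull_corners[OF T t(1), of y]
        vertex_in_hull_corners[OF T t(2), of x] vertex_in_hull_corners[OF T t(2), of y] s(2,3) by fast
    moreover have "\<not> (v x \<in> S \<and> v y \<in> S)" if "convex hull S \<in> T'" for S
      using nl that hull_inc[of "v x" S convex] hull_inc[of "v y" S convex] unfolding linked_def by fast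
    from this[OF t'(1)] this[OF t'(2)]
    have "\<not> (v x \<in> {B, C, D} \<and> v y \<in> {B, C, D})" "\<not> (v x \<in> {A, B, D} \<and> v y \<in> {A, B, D})" .
    ultimately show ?thesis using ne by auto
  qed
  have "d = e" if de: "d \<in> edges T - edges T'" "e \<in> edges T - edges T'" for d e
  proof -
    obtain x y x' y' where *: "d = (x, y)" "e = (x', y')" by force
    have r: "0 \<le> x" "x < y" "y < int p" "0 \<le> x'" "x' < y'" "y' < int p"
      using de * by (auto simp: edges_def)
    have inj: "v i = v j \<Longrightarrow> i = j" if "0 \<le> i" "i < int p" "0 \<le> j" "j < int p" for i j
      using vertex_neq[of i j] vertex_neq[of j i] that by (cases i j rule: linorder_cases) auto
    have "{v x, v y} = {v x', v y'}" using key[of x y] key[of x' y'] de * by simp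
    then have "v x = v x' \<and> v y = v y' \<or> v x = v y' \<and> v y = v x'" by (auto simp: doubleton_eq_iff)
    then show ?thesis using inj[of x x'] inj[of y y'] inj[of x y'] inj[of y x'] r * by auto
  qed
  then show ?thesis
    using finite_edges by (auto simp: card_le_Suc0_iff_eq finite_Diff)
qed

lemma card_edges_flips:
  assumes "(flip c a p ^^ n) T T'"
  shows "card (edges T - edges T') \<le> n"
  using assms
proof (induction n arbitrary: T')
  case (Suc n)
  then obtain T'' where 1: "(flip c a p ^^ n) T T''" and 2: "flip c a p T'' T'" by auto
  have "card (edges T - edges T') \<le> card ((edges T - edges T'') \<union> (edges T'' - edges T'))"
    by (rule card_mono) (auto simp: finite_edges)
  also have "\<dots> \<le> card (edges T - edges T'') + card (edges T'' - edges T')" by (rule card_Un_le)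
  also have "\<dots> \<le> n + 1" using Suc.IH[OF 1] card_edges_flip[OF 2] by (rule add_mono)
  finally show ?case by simp
qed simp

text \<open>Chords are lifted to their shorter arcs; a diameter has none, but it crosses all its rotations.\<close>
definition arcs :: "complex set set \<Rightarrow> (int \<times> int) set" where
  "arcs T = {(x, y). x < y \<and> 2 * (y - x) < int p \<and> link T x y}"

lemma arc_system_arcs:
  assumes T: "polygon_triangulation c a p T"
  shows "arc_system (int p) (arcs T)"
  unfolding arc_system_def
proof (intro conjI allI impI)
  fix x y x' y' assume e: "(x, y) \<in> arcs T" "(x', y') \<in> arcs T"
  show "\<not> (x < x' \<and> x' < y \<and> y < y')"
  proof
    assume "x < x' \<and> x' < y \<and> y < y'"
    \<comment> \<open>Two overlapping arcs, each shorter than half a turn, together span less than a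
      full turn, as \<open>link_noncrossing\<close> requires.\<close>
    then show False using link_noncrossing[OF T, of x y x' y'] e by (auto simp: arcs_def)
  qed
qed (auto simp: arcs_def link_period)

lemma card_paired_arcs_ge:
  assumes T: "polygon_triangulation c a p T" and q: "0 < q" "q < int p" "2 * q \<noteq> int p"
  shows "card {(x, y). (x, y) \<in> edges T \<and> link T (x + q) (y + q)} \<le> card (window 0 (int p) (paired q (arcs T)))"
proof -
  \<comment> \<open>If the arc from \<open>x\<close> to \<open>y\<close> is too long, the chord is
    lifted to the complementary arc, from \<open>y\<close> to \<open>x + p\<close>.\<close>
  define f where "f = (\<lambda>(x, y). if 2 * (y - x) < int p then (x, y) else (y, x + int p))"
  let ?E = "{(x, y). (x, y) \<in> edges T \<and> link T (x + q) (y + q)}"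
  have "f ` ?E \<subseteq> window 0 (int p) (paired q (arcs T))"
  proof (rule image_subsetI)
    fix d assume "d \<in> ?E"
    then obtain x y where d: "d = (x, y)" and e: "(x, y) \<in> edges T" and l': "link T (x + q) (y + q)"
      by blast
    have x: "0 \<le> x" "x < y" "y < int p" and l: "link T x y" using e by (auto simp: edges_def)
    have per: "link T y (x + int p)" "link T (y + q) (x + int p + q)"
      using l l' link_period(2)[of T y x] link_period(2)[of T "y + q" "x + q"] linked_commute[of c a p T]
      by (auto simp: algebra_simps)
    have "2 * (y - x) \<noteq> int p"
    proof
      assume d: "2 * (y - x) = int p"
      have "q \<noteq> y - x" using d q(3) by auto
      \<comment> \<open>Rotated by less than half a turn, the diameter crosses its lift from
        \<open>x\<close> to \<open>y\<close>; rotated by more, it crosses the lift from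
        \<open>y\<close> to \<open>x + p\<close>.\<close>
      then consider "q < y - x" | "y - x < q" by (rule linorder_neqE)
      then show False
      proof cases
        case 1 then show False using link_noncrossing[OF T l l'] d q x by simp
      next
        case 2 then show False using link_noncrossing[OF T per(1), of "x + q" "y + q"] l' d q x by simp
      qed
    qed
    then show "f d \<in> window 0 (int p) (paired q (arcs T))"
      unfolding d using x l l' per by (auto simp: f_def window_def paired_def arcs_def algebra_simps)
  qed
  moreover have "inj_on f ?E"
    by (auto simp: inj_on_def f_def edges_def split: if_splits)
  ultimately show ?thesis
    using card_inj_on_le finite_window_paired[OF arc_system_arcs[OF T] q(1,2)] by blast
qed

lemma link_rotate:
  assumes "T' = (\<lambda>t. rotate_about c (2 * pi * real q / real p) ` t) ` T"
  shows "link T' (i + int q) (j + int q) \<longleftrightarrow> link T i j"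
proof -
  have "v (i + int q) \<in> rotate_about c (2 * pi * real q / real p) ` t \<longleftrightarrow> v i \<in> t" for i t
    unfolding rotate_about_vertex[symmetric] using rotate_about_inj by (simp add: inj_image_mem_iff)
  then show ?thesis unfolding linked_def assms by auto
qed

end

theorem theorem4:
  fixes p q :: nat and c a :: complex and T1 T2 :: "complex set set"
  assumes "3 \<le> p" and "0 < q" and "q < p" and "coprime p q"
    and "a \<noteq> 0"
    and "polygon_triangulation c a p T1"
    and "polygon_triangulation c a p T2"
    and "T2 = (\<lambda>t. rotate_about c (2 * pi * real q / real p) ` t) ` T1"
  shows "enat (euclid_subtractions p q) \<le> rotation_distance c a p T1 T2 + 3"
proof -
  interpret regular_polygon c a p using \<open>a \<noteq> 0\<close> \<open>3 \<le> p\<close> by unfold_locales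
  have p0: "0 < p" and q': "0 < p - q" "p - q < p" using assms(1-3) by auto
  have "gcd (p - q) q = 1"
    using assms(3,4) gcd_diff1_nat[of q p] by (simp add: coprime_iff_gcd_eq_1)
  then have cop: "coprime p (p - q)"
    using assms(3) gcd_add2[of "p - q" q] by (simp add: coprime_iff_gcd_eq_1 gcd.commute)
  have ne: "2 * (p - q) \<noteq> p"
  proof
    assume "2 * (p - q) = p"
    then have "p - q dvd p" by (metis dvd_triv_right)
    then have "p - q = 1" using cop by (metis coprime_common_divisor_nat dvd_refl is_unit_gcd)
    then show False using \<open>2 * (p - q) = p\<close> assms(1) by simp
  qed
  \<comment> \<open>A chord of \<open>T2\<close> becomes one of \<open>T1\<close> when rotated back
    by \<open>q\<close>, which modulo \<open>p\<close> is a rotation forward by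
    \<open>p - q\<close>. So the common chords are those of \<open>T1\<close> paired by
    \<open>p - q\<close>.\<close>
  have shift: "link T1 (x + int (p - q)) (y + int (p - q)) \<longleftrightarrow> link T2 x y" for x y
    using link_rotate[OF assms(8), of "x - int q" "y - int q"] link_period[of T1 "x - int q"]
      link_period[of T1 _ "y - int q"] assms(3)
    by (simp add: of_nat_diff algebra_simps)
  \<comment> \<open>The subtraction truncates at \<open>0\<close>; the inequality with
    \<open>3\<close> added on the right follows all the same. Bounding every attainable
    \<open>n\<close> also covers an infinite distance.\<close>
  have "enat (euclid_subtractions p q - 3) \<le> rotation_distance c a p T1 T2"
    unfolding rotation_distance_def
  proof (rule INF_greatest)
    fix n assume "n \<in> {n. (flip c a p ^^ n) T1 T2}"
    then have "card (edges T1 - edges T2) \<le> n" by (simp add: card_edges_flips)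
    moreover have "card (edges T1) = card (edges T1 - edges T2) + card (edges T1 \<inter> edges T2)"
      using finite_edges by (metis Diff_Int_distrib2 add.commute card_Int_Diff)
    moreover have "edges T1 \<inter> edges T2 = {(x, y). (x, y) \<in> edges T1 \<and> link T1 (x + int (p - q)) (y + int (p - q))}"
      unfolding shift by (auto simp: edges_def)
    then have "card (edges T1 \<inter> edges T2) \<le> card (window 0 (int p) (paired (int (p - q)) (arcs T1)))"
      using card_paired_arcs_ge[OF assms(6), of "int (p - q)"] q' ne by simp
    moreover have "card (window 0 (int p) (paired (int (p - q)) (arcs T1))) + euclid_subtractions p (p - q) \<le> 2 * p"
      by (rule card_paired_bound[OF q' cop arc_system_arcs[OF assms(6)]])
    moreover have "2 * p \<le> card (edges T1) + 3" by (rule card_edges_ge[OF assms(6)])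
    moreover have "euclid_subtractions p (p - q) = euclid_subtractions p q"
      by (rule euclid_subtractions_complement[OF assms(2,3)])
    \<comment> \<open>At least \<open>2 * p - 3\<close> chords, of which at most
      \<open>2 * p - euclid_subtractions p q\<close> are common; the rest have to be flipped away
      one by one.\<close>
    ultimately show "enat (euclid_subtractions p q - 3) \<le> enat n" by simp
  qed
  then have "enat (euclid_subtractions p q - 3) + enat 3 \<le> rotation_distance c a p T1 T2 + enat 3"
    by (rule add_right_mono)
  moreover have "enat (euclid_subtractions p q) \<le> enat (euclid_subtractions p q - 3) + enat 3"
    by simp
  ultimately have "enat (euclid_subtractions p q) \<le> rotation_distance c a p T1 T2 + enat 3"
    by (rule order_trans[rotated])
  then show ?thesis by (simp add: numeral_eq_enat)
qed

end
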